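(* Let $\gamma\in(\frac34,1)$, let $\omega=(\omega_1,\dots,\omega_N)\in[\gamma,1]^N$, let $\nu_\omega(S)=|S|$, and let $C_1,C_2$ be the absolute constants described in the context. If $m,s,N\in\mathbb{N}$ satisfy $$\frac{N}{2}\ge m\ge 242\,(\log 10)\,C_1C_2\,s\log^4(N),\qquad N\ge24s,\qquad s\ge3717120,$$ then there exists a matrix $\Phi\in\mathbb{C}^{m\times N}$ that satisfies $\omega$-NSP of order $s$ but does not satisfy $\omega$-RIP-NSP of order $2s$ with $\delta_{2s}<\frac{1}{11}$ (that is, no matrix with the same null space as $\Phi$ has RIP constant of order $2s$ less than $\frac1{11}$).
   Context: $[N]=\{1,\dots,N\}$; $\|x\|_{\omega,1}=\sum_{j=1}^N\omega_j|x_j|$; for $S\subset[N]$, $x_S$ equals $x$ on $S$ and is zero elsewhere, $S^c=[N]\setminus S$; $\log$ is the natural logarithm. $\omega$-NSP of order $s$: $A\in\mathbb{C}^{m\times N}$ satisfies it if $\|v_S\|_{\omega,1}<\|v_{S^c}\|_{\omega,1}$ for all $v\in\ker(A)\setminus\{0\}$ and all $S\subset[N]$ with $|S|\le s$. $\omega$-RIP (here the same as the standard RIP, since $\nu_\omega(S)=|S|$): the constant $\delta_k$ of order $k$ of a matrix $A$ is the smallest number such that $(1-\delta_k)\|x\|_2^2\le\|Ax\|_2^2\le(1+\delta_k)\|x\|_2^2$ for every $x\in\mathbb{C}^N$ with $|\operatorname{supp}x|\le k$. A matrix $\Phi$ satisfies $\omega$-RIP-NSP of order $k$ with $\delta_k$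 if it has the same null space as a matrix that satisfies $\omega$-RIP of order $k$ with constant $\delta_k$. The constants $C_1,C_2$: absolute constants for which the following theorem (Cahill et al.) holds. For any fixed absolute constant $\delta<1$, when $m,N,s$ satisfy $m\ge C_1ts\log^4N$, the random partial Fourier matrix formed by randomly choosing $m$ rows from the $N\times N$ DFT matrix satisfies RIP with $\delta_{2s}\le\delta$ with probability $1-5e^{-\delta^2t/C_2}$. *)

theory Defs
  imports
    "HOL-Probability.Probability"
    "Jordan_Normal_Form.Matrix_Kernel"
    "Jordan_Normal_Form.DL_Submatrix"
begin

unbundle no vec_syntax

text \<open>Coordinates of vectors of length \<open>N\<close> are indexed by \<open>{0..<N}\<close> rather than by \<open>{1..N}\<close>.\<close>

definition supp_vec :: "complex vec \<Rightarrow> nat set" where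
  "supp_vec x = {i. i < dim_vec x \<and> x $ i \<noteq> 0}"

definition norm2 :: "complex vec \<Rightarrow> real" where
  "norm2 x = sqrt (\<Sum>i<dim_vec x. (cmod (x $ i))\<^sup>2)"

definition wnorm1 :: "real vec \<Rightarrow> complex vec \<Rightarrow> real" where
  "wnorm1 \<omega> x = (\<Sum>j<dim_vec x. \<omega> $ j * cmod (x $ j))"

definition restr_vec :: "nat set \<Rightarrow> complex vec \<Rightarrow> complex vec" where
  "restr_vec S x = Matrix.vec (dim_vec x) (\<lambda>j. if j \<in> S then x $ j else 0)"

definition wNSP :: "real vec \<Rightarrow> nat \<Rightarrow> complex mat \<Rightarrow> bool" where
  "wNSP \<omega> s A \<longleftrightarrow>
    (\<forall>v \<in> mat_kernel A - {0\<^sub>v (dim_col A)}. \<forall>S \<subseteq> {0..<dim_col A}. card S \<le> s \<longrightarrow>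
      wnorm1 \<omega> (restr_vec S v) < wnorm1 \<omega> (restr_vec ({0..<dim_col A} - S) v))"

definition RIP_bound :: "nat \<Rightarrow> real \<Rightarrow> complex mat \<Rightarrow> bool" where
  "RIP_bound k \<delta> A \<longleftrightarrow>
    (\<forall>x \<in> carrier_vec (dim_col A). card (supp_vec x) \<le> k \<longrightarrow>
      (1 - \<delta>) * (norm2 x)\<^sup>2 \<le> (norm2 (A *\<^sub>v x))\<^sup>2 \<and>
      (norm2 (A *\<^sub>v x))\<^sup>2 \<le> (1 + \<delta>) * (norm2 x)\<^sup>2)"

text \<open>For \<open>k \<ge> 1\<close> and \<open>dim_col A \<ge> 1\<close> the admissible \<open>\<delta>\<close> form a nonempty closed set of
  nonnegative reals, so the minimum exists. The constant is only used in this range.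
  With \<open>\<nu>(S) = card S\<close> the weighted RIP does not involve the weights and is the usual RIP.\<close>

definition RIP_const :: "nat \<Rightarrow> complex mat \<Rightarrow> real" where
  "RIP_const k A = (LEAST \<delta>. RIP_bound k \<delta> A)"

text \<open>The matrix \<open>\<Psi>\<close> may have any number of rows.\<close>

definition RIP_NSP :: "nat \<Rightarrow> real \<Rightarrow> complex mat \<Rightarrow> bool" where
  "RIP_NSP k \<delta> \<Phi> \<longleftrightarrow>
    (\<exists>\<Psi>. dim_col \<Psi> = dim_col \<Phi> \<and> mat_kernel \<Psi> = mat_kernel \<Phi> \<and> RIP_const k \<Psi> = \<delta>)"

definition DFT_mat :: "nat \<Rightarrow> complex mat" where
  "DFT_mat N = mat N N (\<lambda>(j, k). cis (- (2 * pi * real j * real k / real N)))"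

text \<open>The rows of the DFT matrix with index in \<open>R\<close>. The factor \<open>1 / sqrt (card R)\<close> makes all
  columns unit vectors, the scaling in which the RIP of a partial Fourier matrix is stated.\<close>

definition partial_DFT :: "nat \<Rightarrow> nat set \<Rightarrow> complex mat" where
  "partial_DFT N R =
    complex_of_real (1 / sqrt (real (card R))) \<cdot>\<^sub>m submatrix (DFT_mat N) R UNIV"

text \<open>The set of row indices is uniformly distributed over all \<open>m\<close>-element subsets of
  \<open>{0..<N}\<close> (sampling without replacement). The constants do not depend on \<open>\<delta>\<close>, \<open>t\<close> or
  the dimensions.\<close>

definition partial_DFT_RIP_constants :: "real \<Rightarrow> real \<Rightarrow> bool" where
  "partial_DFT_RIP_constants C1 C2 \<longleftrightarrow> C1 > 0 \<and> C2 > 0 \<and>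
    (\<forall>\<delta> t. \<forall>m N s :: nat. 0 < \<delta> \<longrightarrow> \<delta> < 1 \<longrightarrow> t > 0 \<longrightarrow> 1 \<le> s \<longrightarrow> 1 \<le> m \<longrightarrow> m \<le> N \<longrightarrow>
      real m \<ge> C1 * t * real s * ln (real N) ^ 4 \<longrightarrow>
      measure_pmf.prob (pmf_of_set {R. R \<subseteq> {0..<N} \<and> card R = m})
        {R. RIP_const (2 * s) (partial_DFT N R) \<le> \<delta>} \<ge> 1 - 5 * exp (- (\<delta>\<^sup>2 * t / C2)))"

end

theory Submission
  imports Defs
begin

text \<open>
  The null space of a matrix with a good RIP constant is enlarged by one flat vector, chosen so
  that it respects the null space property but not the restricted isometry property.

  Applied with sparsity \<open>34 s\<close>, \<open>\<delta> = 3/8\<close> and \<open>t = 242 (ln 10) C2 / 34\<close>, the hypothesis on \<open>C1\<close>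
  and \<open>C2\<close> asks for exactly the lower bound on \<open>m\<close> that is assumed, and since
  \<open>(3/8)\<^sup>2 t / C2 \<ge> ln 10\<close> the failure probability is at most \<open>5/10\<close>. So some partial Fourier
  matrix \<open>A\<close> with \<open>m\<close> rows satisfies the RIP of order \<open>68 s\<close> with constant \<open>3/8\<close>
  (\<open>exists_partial_DFT_RIP\<close>). Let \<open>v\<close> be the indicator vector of a set of \<open>4 s\<close> coordinates.
  Then \<open>A v \<noteq> 0\<close>, and subtracting multiples of one row of \<open>A\<close> from all rows gives a matrix \<open>\<Phi>\<close>
  of the same size whose null space is \<open>{x. A x \<in> span (A v)} = ker A + span v\<close>
  (\<open>exists_matrix_kernel_preimage_line\<close>).

  \<^emph>\<open>No RIP.\<close> Let \<open>\<Psi> v = 0\<close>, and split \<open>v = v1 + v2 + v3 + v4\<close> into indicators of \<open>s\<close>-sets.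
  The images \<open>a, b, c, d\<close> of the parts under \<open>\<Psi>\<close> have sum zero, whence
  \<open>|a + b|\<^sup>2 + |a + c|\<^sup>2 + |b + c|\<^sup>2 = |a|\<^sup>2 + |b|\<^sup>2 + |c|\<^sup>2 + |d|\<^sup>2\<close>. An RIP constant \<open>\<delta>\<close> of order
  \<open>2 s\<close> gives \<open>6 s (1 - \<delta>) \<le> 4 s (1 + \<delta>)\<close>, that is \<open>\<delta> \<ge> 1/5\<close>
  (\<open>RIP_bound_ge_if_flat_kernel_vector\<close>).

  \<^emph>\<open>NSP.\<close> Let \<open>A x = c A v\<close> and suppose that \<open>x\<close> violates the weighted inequality at a set \<open>T\<close>
  of size at most \<open>s\<close>. All weights lie in \<open>[3/4, 1]\<close>, so the \<open>\<ell>\<^sub>1\<close> norm of \<open>x\<close> off \<open>T\<close> is at most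
  \<open>4/3\<close> times that on \<open>T\<close>. Let \<open>y\<close> be the \<open>\<ell>\<^sub>2\<close> norm of \<open>x\<close> on \<open>T\<close>. Cutting the part of \<open>x\<close>
  off \<open>T\<close> into blocks of decreasing entries (\<open>block_decomposition\<close>) yields a set \<open>B\<close> of size at most
  \<open>63 s\<close> such that \<open>A\<close> nearly annihilates \<open>x\<close> off \<open>T \<union> B\<close>. Hence \<open>A\<close> nearly annihilates the sparse
  vector \<open>z = x\<^bsub>T \<union> B\<^esub> - c v\<close>, and the RIP gives \<open>|z| \<le> y/4\<close>. On \<open>T\<close> this means
  \<open>y \<le> y/4 + |c| \<surd>s\<close>, so \<open>c\<close> cannot be small compared with \<open>y\<close>; on the support of \<open>v\<close> it means
  \<open>4 s |c| \<le> 2 \<surd>s \<sqdot> y/4 + (7/3) \<surd>s y\<close>, so \<open>c\<close> cannot be large. Together they force \<open>y = 0\<close>, and then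
  \<open>x = 0\<close> (\<open>kernel_plus_flat_vector_NSP\<close>).
\<close>

section \<open>Norms and restrictions of vectors\<close>

lemma norm2_conv_L2_set: "norm2 x = L2_set (\<lambda>i. cmod (x $ i)) {..<dim_vec x}"
  by (simp add: norm2_def L2_set_def)

lemma norm2_sq: "(norm2 x)\<^sup>2 = (\<Sum>i<dim_vec x. (cmod (x $ i))\<^sup>2)"
  by (simp add: norm2_def sum_nonneg)

lemma norm2_nonneg: "0 \<le> norm2 x"
  by (simp add: norm2_def sum_nonneg)

lemma norm2_triangle:
  assumes "dim_vec x = dim_vec y"
  shows "norm2 (x + y) \<le> norm2 x + norm2 y"
proof -
  have "norm2 (x + y) \<le> L2_set (\<lambda>i. cmod (x $ i) + cmod (y $ i)) {..<dim_vec y}"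
    unfolding norm2_conv_L2_set
    by (auto intro!: L2_set_mono norm_triangle_ineq simp: assms)
  also have "\<dots> \<le> norm2 x + norm2 y"
    unfolding norm2_conv_L2_set assms by (rule L2_set_triangle_ineq)
  finally show ?thesis .
qed

lemma norm2_uminus: "norm2 (- x) = norm2 x"
  by (simp add: norm2_def)

lemma norm2_restr_sq:
  assumes "B \<subseteq> {..<dim_vec x}"
  shows "(norm2 (restr_vec B x))\<^sup>2 = (\<Sum>i\<in>B. (cmod (x $ i))\<^sup>2)"
proof -
  have "(norm2 (restr_vec B x))\<^sup>2 = (\<Sum>i<dim_vec x. if i \<in> B then (cmod (x $ i))\<^sup>2 else 0)"
    unfolding norm2_sq by (intro sum.cong) (auto simp: restr_vec_def)
  also have "\<dots> = (\<Sum>i\<in>B. (cmod (x $ i))\<^sup>2)"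
    using assms by (simp add: sum.inter_restrict[symmetric] Int_absorb1)
  finally show ?thesis .
qed

lemma wnorm1_restr:
  assumes "B \<subseteq> {0..<dim_vec x}"
  shows "wnorm1 w (restr_vec B x) = (\<Sum>j\<in>B. w $ j * cmod (x $ j))"
proof -
  have "wnorm1 w (restr_vec B x) = (\<Sum>j\<in>{0..<dim_vec x}. if j \<in> B then w $ j * cmod (x $ j) else 0)"
    unfolding wnorm1_def by (intro sum.cong) (auto simp: restr_vec_def)
  also have "\<dots> = (\<Sum>j\<in>B. w $ j * cmod (x $ j))"
    using assms by (simp add: sum.inter_restrict[symmetric] Int_absorb1)
  finally show ?thesis .
qed

lemma supp_restr_vec: "supp_vec (restr_vec B x) \<subseteq> B"
  by (auto simp: supp_vec_def restr_vec_def split: if_splits)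

lemma restr_vec_carrier [simp]: "x \<in> carrier_vec n \<Longrightarrow> restr_vec B x \<in> carrier_vec n"
  by (auto simp: restr_vec_def)

section \<open>The restricted isometry constant\<close>

text \<open>The Frobenius norm bounds the operator norm.\<close>

lemma norm2_mult_vec_le:
  assumes "x \<in> carrier_vec (dim_col A)"
  shows "(norm2 (A *\<^sub>v x))\<^sup>2 \<le> (\<Sum>i<dim_row A. \<Sum>j<dim_col A. (cmod (A $$ (i, j)))\<^sup>2) * (norm2 x)\<^sup>2"
proof -
  have "(cmod ((A *\<^sub>v x) $ i))\<^sup>2 \<le> (\<Sum>j<dim_col A. (cmod (A $$ (i, j)))\<^sup>2) * (norm2 x)\<^sup>2"
    if "i < dim_row A" for i
  proof -
    have "cmod ((A *\<^sub>v x) $ i) = cmod (\<Sum>j<dim_col A. A $$ (i, j) * x $ j)"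
      using that assms by (auto simp: scalar_prod_def atLeast0LessThan intro!: arg_cong[where f = cmod] sum.cong)
    also have "\<dots> \<le> (\<Sum>j<dim_col A. cmod (A $$ (i, j)) * cmod (x $ j))"
      by (rule order_trans[OF norm_sum]) (simp add: norm_mult)
    finally have "(cmod ((A *\<^sub>v x) $ i))\<^sup>2 \<le> (\<Sum>j<dim_col A. cmod (A $$ (i, j)) * cmod (x $ j))\<^sup>2"
      by (intro power_mono) auto
    also have "\<dots> \<le> (\<Sum>j<dim_col A. (cmod (A $$ (i, j)))\<^sup>2) * (\<Sum>j<dim_col A. (cmod (x $ j))\<^sup>2)"
      by (rule Cauchy_Schwarz_ineq_sum)
    finally show ?thesis using assms by (simp add: norm2_sq)
  qed
  then show ?thesis
    unfolding norm2_sq[of "A *\<^sub>v x"] by (auto simp: sum_distrib_right intro!: sum_mono)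
qed

lemma RIP_bound_mono:
  assumes "RIP_bound k \<delta> A" "\<delta> \<le> \<delta>'"
  shows "RIP_bound k \<delta>' A"
  unfolding RIP_bound_def
proof (intro ballI impI)
  fix x assume x: "x \<in> carrier_vec (dim_col A)" "card (supp_vec x) \<le> k"
  have "(1 - \<delta>') * (norm2 x)\<^sup>2 \<le> (1 - \<delta>) * (norm2 x)\<^sup>2" "(1 + \<delta>) * (norm2 x)\<^sup>2 \<le> (1 + \<delta>') * (norm2 x)\<^sup>2"
    using assms(2) by (intro mult_right_mono; simp)+
  with x assms(1) show "(1 - \<delta>') * (norm2 x)\<^sup>2 \<le> (norm2 (A *\<^sub>v x))\<^sup>2 \<and>
      (norm2 (A *\<^sub>v x))\<^sup>2 \<le> (1 + \<delta>') * (norm2 x)\<^sup>2"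
    unfolding RIP_bound_def by force
qed

text \<open>The least constant of \<^const>\<open>RIP_const\<close> exists: the admissible constants are bounded
  below by 0 (test on a unit vector), include every large number, and contain their infimum.\<close>

lemma RIP_bound_RIP_const:
  assumes "1 \<le> k" "1 \<le> dim_col A"
  shows "RIP_bound k (RIP_const k A) A"
proof -
  let ?D = "{\<delta>. RIP_bound k \<delta> A}"
  let ?F = "\<Sum>i<dim_row A. \<Sum>j<dim_col A. (cmod (A $$ (i, j)))\<^sup>2"
  have "RIP_bound k (max 1 ?F) A"
    unfolding RIP_bound_def
  proof (intro ballI impI conjI)
    fix x :: "complex vec" assume x: "x \<in> carrier_vec (dim_col A)"
    have "(1 - max 1 ?F) * (norm2 x)\<^sup>2 \<le> 0" by (intro mult_nonpos_nonneg) auto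
    then show "(1 - max 1 ?F) * (norm2 x)\<^sup>2 \<le> (norm2 (A *\<^sub>v x))\<^sup>2"
      using zero_le_power2 order_trans by blast
    have "(norm2 (A *\<^sub>v x))\<^sup>2 \<le> ?F * (norm2 x)\<^sup>2" by (rule norm2_mult_vec_le[OF x])
    also have "\<dots> \<le> (1 + max 1 ?F) * (norm2 x)\<^sup>2" by (intro mult_right_mono) auto
    finally show "(norm2 (A *\<^sub>v x))\<^sup>2 \<le> (1 + max 1 ?F) * (norm2 x)\<^sup>2" .
  qed
  then have ne: "?D \<noteq> {}" by blast
  have nonneg: "0 \<le> \<delta>" if "\<delta> \<in> ?D" for \<delta>
  proof -
    let ?e = "unit_vec (dim_col A) 0 :: complex vec"
    have "supp_vec ?e \<subseteq> {0}" by (auto simp: supp_vec_def unit_vec_def split: if_splits)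
    then have c: "card (supp_vec ?e) \<le> k" using assms(1) card_mono[of "{0}" "supp_vec ?e"] by simp
    have "(norm2 ?e)\<^sup>2 = (\<Sum>i<dim_col A. if i = 0 then 1 else 0)"
      unfolding norm2_sq by (intro sum.cong) (auto simp: unit_vec_def)
    then have n: "(norm2 ?e)\<^sup>2 = 1" using assms(2) by (simp add: sum.delta)
    have "(1 - \<delta>) * 1 \<le> (1 + \<delta>) * 1"
      using that c unfolding RIP_bound_def mem_Collect_eq n[symmetric]
      by (meson order_trans unit_vec_carrier)
    then show ?thesis by simp
  qed
  then have bdd: "bdd_below ?D" by (auto intro!: bdd_belowI[of _ 0])
  define d where "d = Inf ?D"
  have *: "RIP_bound k d A"
    unfolding RIP_bound_def
  proof (intro ballI impI)
    fix x :: "complex vec" assume x: "x \<in> carrier_vec (dim_col A)" "card (supp_vec x) \<le> k"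
    have ev: "RIP_bound k (d + e) A" if e: "e > 0" for e
    proof -
      obtain d' where "d' \<in> ?D" "d' < d + e"
        using cInf_lessD[OF ne, of "d + e"] e d_def by auto
      then show ?thesis using RIP_bound_mono[of k d' A] by auto
    qed
    show "(1 - d) * (norm2 x)\<^sup>2 \<le> (norm2 (A *\<^sub>v x))\<^sup>2 \<and>
      (norm2 (A *\<^sub>v x))\<^sup>2 \<le> (1 + d) * (norm2 x)\<^sup>2"
    proof (cases "norm2 x = 0")
      case True
      then show ?thesis using ev[of 1] x unfolding RIP_bound_def by force
    next
      case False
      then have p: "0 < (norm2 x)\<^sup>2" by simp
      have 1: "(1 - d) * (norm2 x)\<^sup>2 \<le> (norm2 (A *\<^sub>v x))\<^sup>2 + e \<and>
          (norm2 (A *\<^sub>v x))\<^sup>2 \<le> (1 + d) * (norm2 x)\<^sup>2 + e" if "0 < e" for e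
      proof -
        from ev[of "e / (norm2 x)\<^sup>2"] that p x
        have "(1 - (d + e / (norm2 x)\<^sup>2)) * (norm2 x)\<^sup>2 \<le> (norm2 (A *\<^sub>v x))\<^sup>2"
          "(norm2 (A *\<^sub>v x))\<^sup>2 \<le> (1 + (d + e / (norm2 x)\<^sup>2)) * (norm2 x)\<^sup>2"
          unfolding RIP_bound_def by auto
        then show ?thesis using p by (simp add: algebra_simps)
      qed
      show ?thesis
        using 1 by (intro conjI) (rule field_le_epsilon; blast)+
    qed
  qed
  have "RIP_const k A = d"
    unfolding RIP_const_def
    by (rule Least_equality, rule *) (auto simp: d_def intro: cInf_lower bdd)
  with * show ?thesis by simp
qed

lemma RIP_boundD:
  assumes "RIP_bound k \<delta> A" "x \<in> carrier_vec (dim_col A)" "supp_vec x \<subseteq> S" "finite S" "card S \<le> k"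
  shows "(1 - \<delta>) * (norm2 x)\<^sup>2 \<le> (norm2 (A *\<^sub>v x))\<^sup>2"
    and "(norm2 (A *\<^sub>v x))\<^sup>2 \<le> (1 + \<delta>) * (norm2 x)\<^sup>2"
proof -
  have "card (supp_vec x) \<le> k"
    using card_mono[OF assms(4,3)] assms(5) by simp
  then show "(1 - \<delta>) * (norm2 x)\<^sup>2 \<le> (norm2 (A *\<^sub>v x))\<^sup>2"
    and "(norm2 (A *\<^sub>v x))\<^sup>2 \<le> (1 + \<delta>) * (norm2 x)\<^sup>2"
    using assms(1,2) unfolding RIP_bound_def by auto
qed

section \<open>Decomposition into blocks of decreasing size\<close>

lemma exists_subset_of_largest:
  fixes f :: "'a \<Rightarrow> real"
  assumes "finite U" "M \<le> card U"
  shows "\<exists>B\<subseteq>U. card B = M \<and> (\<forall>a\<in>U - B. \<forall>b\<in>B. f a \<le> f b)"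
  using assms(2)
proof (induction M)
  case 0
  then show ?case by (auto intro!: exI[of _ "{}"])
next
  case (Suc M)
  then obtain B where B: "B \<subseteq> U" "card B = M" "\<forall>a\<in>U - B. \<forall>b\<in>B. f a \<le> f b"
    by auto
  have "U - B \<noteq> {}" 
    using B Suc.prems card_mono[OF finite_subset[OF B(1) assms(1)], of U] by auto
  then have "Max (f ` (U - B)) \<in> f ` (U - B)" using assms(1) by (intro Max_in) auto
  then obtain c where c: "c \<in> U - B" "f c = Max (f ` (U - B))" by auto
  have "f a \<le> f c" if "a \<in> U - B" for a
    using that assms(1) unfolding c(2) by (intro Max_ge) auto
  moreover have "card (insert c B) = Suc M"
    using B c assms(1) by (auto simp: finite_subset card_insert_if)
  ultimately show ?case using B c
    by (intro exI[of _ "insert c B"]) auto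
qed

text \<open>For \<open>q\<close> the norm of the image of a restriction of \<open>x\<close>, this bounds the contribution of
  everything but one block by the \<open>\<ell>\<^sub>1\<close> norm. Take for \<open>B\<close> the \<open>M\<close> largest entries: every entry in
  the next block \<open>B'\<close> is at most the mean over \<open>B\<close>, so the \<open>\<ell>\<^sub>2\<close> norm on \<open>B'\<close> is at most the \<open>\<ell>\<^sub>1\<close> norm
  on \<open>B\<close> divided by \<open>sqrt M\<close>, and these bounds add up.\<close>

lemma block_decomposition:
  fixes f :: "'a \<Rightarrow> real" and q :: "'a set \<Rightarrow> real"
  assumes "finite U" "1 \<le> M" "0 \<le> K"
    and f: "\<And>j. 0 \<le> f j"
    and q0: "q {} = 0"
    and sub: "\<And>S S'. S \<subseteq> U \<Longrightarrow> S' \<subseteq> U \<Longrightarrow> S \<inter> S' = {} \<Longrightarrow> q (S \<union> S') \<le> q S + q S'"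
    and bd: "\<And>S. S \<subseteq> U \<Longrightarrow> card S \<le> M \<Longrightarrow> q S \<le> K * L2_set f S"
  shows "\<exists>B\<subseteq>U. card B \<le> M \<and> q (U - B) \<le> K * (sum f U / sqrt (real M))"
  using assms(1) sub bd
proof (induction "card U" arbitrary: U rule: less_induct)
  case less
  show ?case
  proof (cases "card U \<le> M")
    case True
    then show ?thesis using assms(3) f q0
      by (intro exI[of _ U]) (auto intro!: mult_nonneg_nonneg divide_nonneg_nonneg sum_nonneg)
  next
    case False
    then obtain B where B: "B \<subseteq> U" "card B = M" "\<forall>a\<in>U - B. \<forall>b\<in>B. f a \<le> f b"
      using exists_subset_of_largest[of U M f] less.prems(1) by auto
    have "card (U - B) < card U" using B less.prems(1) assms(2)
      by (metis Diff_subset card_0_eq card_seteq finite_subset double_diff Diff_cancel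
          not_less not_one_le_zero)
    then obtain B' where B': "B' \<subseteq> U - B" "card B' \<le> M"
      "q (U - B - B') \<le> K * (sum f (U - B) / sqrt (real M))"
      using less.hyps[of "U - B"] less.prems by (metis Diff_subset finite_Diff subset_trans)
    have fin: "finite B'" "finite B" using B B' less.prems(1) by (auto intro: finite_subset)
    have small: "f a \<le> sum f B / real M" if "a \<in> B'" for a
    proof -
      have "(\<Sum>b\<in>B. f a) \<le> sum f B" using B B' that by (intro sum_mono) auto
      then show ?thesis using B(2) assms(2) by (simp add: field_simps)
    qed
    have sumB: "0 \<le> sum f B" using f by (simp add: sum_nonneg)
    have "L2_set f B' \<le> L2_set (\<lambda>_. sum f B / real M) B'"
      using small f by (intro L2_set_mono) auto
    also have "\<dots> = sqrt (real (card B')) * (sum f B / real M)"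
      using sumB by (simp add: L2_set_constant)
    also have "\<dots> \<le> sqrt (real M) * (sum f B / real M)"
      using B'(2) sumB by (intro mult_right_mono) auto
    also have "\<dots> = sum f B / sqrt (real M)"
      using assms(2) by (simp add: field_simps)
    finally have L: "L2_set f B' \<le> sum f B / sqrt (real M)" .
    have "q (U - B) = q (B' \<union> (U - B - B'))" using B'(1) by (intro arg_cong[where f = q]) auto
    also have "\<dots> \<le> q B' + q (U - B - B')"
      using B'(1) by (intro less.prems(2)) auto
    also have "\<dots> \<le> K * (sum f B / sqrt (real M)) + K * (sum f (U - B) / sqrt (real M))"
    proof (intro add_mono B'(3))
      have "q B' \<le> K * L2_set f B'" using less.prems(3)[of B'] B' by auto
      also have "\<dots> \<le> K * (sum f B / sqrt (real M))" by (rule mult_left_mono[OF L assms(3)])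
      finally show "q B' \<le> K * (sum f B / sqrt (real M))" .
    qed
    also have "\<dots> = K * (sum f U / sqrt (real M))"
      using sum.subset_diff[OF B(1) less.prems(1), of f]
      by (simp add: add_divide_distrib distrib_left)
    finally show ?thesis using B by (intro exI[of _ B]) auto
  qed
qed

lemma sum_le_sqrt_card_L2_set:
  fixes f :: "'a \<Rightarrow> real"
  shows "sum f S \<le> sqrt (real (card S)) * L2_set f S"
proof -
  have "(sum f S)\<^sup>2 \<le> real (card S) * (L2_set f S)\<^sup>2"
    using Cauchy_Schwarz_ineq_sum[of "\<lambda>_. 1" f S] by (simp add: L2_set_def sum_nonneg)
  then have "\<bar>sum f S\<bar> \<le> sqrt (real (card S) * (L2_set f S)\<^sup>2)"
    by (metis real_sqrt_abs real_sqrt_le_mono)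
  then show ?thesis by (simp add: real_sqrt_mult)
qed

section \<open>A matrix whose null space contains one more vector\<close>

lemma exists_matrix_kernel_preimage_line:
  fixes A :: "complex mat"
  assumes A: "A \<in> carrier_mat m N" and v: "v \<in> carrier_vec N" and nz: "A *\<^sub>v v \<noteq> 0\<^sub>v m"
  shows "\<exists>\<Phi>\<in>carrier_mat m N. mat_kernel \<Phi> = {x \<in> carrier_vec N. \<exists>c. A *\<^sub>v x = c \<cdot>\<^sub>v (A *\<^sub>v v)}"
proof -
  define w where "w = A *\<^sub>v v"
  have wd: "dim_vec w = m" using A by (simp add: w_def)
  from nz obtain p where p: "p < m" "w $ p \<noteq> 0"
    unfolding w_def using A by (metis carrier_matD(1) dim_mult_mat_vec eq_vecI index_zero_vec)
  \<comment> \<open>Row \<open>p\<close> of this matrix is zero, which is harmless: the number of rows stays \<open>m\<close>.\<close>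
  define \<Phi> where "\<Phi> = mat m N (\<lambda>(i, j). A $$ (i, j) - w $ i / w $ p * A $$ (p, j))"
  have carr: "\<Phi> \<in> carrier_mat m N" by (simp add: \<Phi>_def)
  have ent: "(\<Phi> *\<^sub>v x) $ i = (A *\<^sub>v x) $ i - w $ i / w $ p * (A *\<^sub>v x) $ p"
    if "x \<in> carrier_vec N" "i < m" for x i
    using that A p(1)
    by (auto simp: \<Phi>_def scalar_prod_def sum_distrib_left sum_subtractf[symmetric] algebra_simps
        intro!: sum.cong)
  have iff: "\<Phi> *\<^sub>v x = 0\<^sub>v m \<longleftrightarrow> (\<exists>c. A *\<^sub>v x = c \<cdot>\<^sub>v w)" if x: "x \<in> carrier_vec N" for x
  proof
    assume "\<Phi> *\<^sub>v x = 0\<^sub>v m"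
    then have "(A *\<^sub>v x) $ i = w $ i / w $ p * (A *\<^sub>v x) $ p" if "i < m" for i
      using ent[OF x that] that by simp
    then have "A *\<^sub>v x = ((A *\<^sub>v x) $ p / w $ p) \<cdot>\<^sub>v w"
      using A wd by (intro eq_vecI) (auto simp: field_simps)
    then show "\<exists>c. A *\<^sub>v x = c \<cdot>\<^sub>v w" ..
  next
    assume "\<exists>c. A *\<^sub>v x = c \<cdot>\<^sub>v w"
    then obtain c where "A *\<^sub>v x = c \<cdot>\<^sub>v w" ..
    then show "\<Phi> *\<^sub>v x = 0\<^sub>v m"
      using ent[OF x] p wd carr by (intro eq_vecI) auto
  qed
  have "mat_kernel \<Phi> = {x \<in> carrier_vec N. \<exists>c. A *\<^sub>v x = c \<cdot>\<^sub>v w}"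
    unfolding mat_kernel[OF carr] using iff by auto
  with carr show ?thesis unfolding w_def by blast
qed


section \<open>A flat vector in the null space bounds the RIP constant from below\<close>

text \<open>The indicator vector of \<open>S\<close> of length \<open>N\<close>; elements of \<open>S\<close> beyond \<open>N\<close> are ignored.\<close>

definition ind_vec :: "nat \<Rightarrow> nat set \<Rightarrow> complex vec" where
  "ind_vec N S = Matrix.vec N (\<lambda>j. if j \<in> S then 1 else 0)"

lemma ind_vec_carrier [simp]: "ind_vec N S \<in> carrier_vec N"
  by (simp add: ind_vec_def)

lemma dim_ind_vec [simp]: "dim_vec (ind_vec N S) = N"
  by (simp add: ind_vec_def)

lemma index_ind_vec [simp]: "j < N \<Longrightarrow> ind_vec N S $ j = (if j \<in> S then 1 else 0)"
  by (simp add: ind_vec_def)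

lemma supp_ind_vec: "supp_vec (ind_vec N S) \<subseteq> S"
  by (auto simp: supp_vec_def split: if_splits)

lemma norm2_ind_vec_sq:
  assumes "S \<subseteq> {..<N}"
  shows "(norm2 (ind_vec N S))\<^sup>2 = real (card S)"
proof -
  have "(norm2 (ind_vec N S))\<^sup>2 = (\<Sum>j<N. if j \<in> S then 1 else 0)"
    unfolding norm2_sq by (intro sum.cong) auto
  also have "\<dots> = (\<Sum>j\<in>S. 1)"
    using assms by (simp add: sum.inter_restrict[symmetric] Int_absorb1)
  finally show ?thesis by simp
qed

lemma ind_vec_union:
  assumes "S \<inter> S' = {}"
  shows "ind_vec N S + ind_vec N S' = ind_vec N (S \<union> S')"
  using assms by (intro eq_vecI) auto

lemma cmod_sq_four_sum_zero:
  fixes a b c d :: complex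
  assumes "a + b + c + d = 0"
  shows "(cmod (a + b))\<^sup>2 + (cmod (a + c))\<^sup>2 + (cmod (b + c))\<^sup>2 =
    (cmod a)\<^sup>2 + (cmod b)\<^sup>2 + (cmod c)\<^sup>2 + (cmod d)\<^sup>2"
proof -
  have d: "d = - (a + b + c)" using assms by (metis add.commute eq_neg_iff_add_eq_0)
  show ?thesis unfolding d cmod_power2 by (simp add: power2_eq_square algebra_simps)
qed

text \<open>By the identity above, images of the four parts of the flat vector cannot have nearly
  the length of the parts while the pairwise sums also nearly have the length of theirs.\<close>

lemma RIP_bound_ge_if_flat_kernel_vector:
  assumes RIP: "RIP_bound (2 * s) \<delta> \<Psi>" and dim: "dim_col \<Psi> = N" and s: "1 \<le> s"
    and L: "\<And>i. i < 4 \<Longrightarrow> L i \<subseteq> {..<N}" "\<And>i. i < 4 \<Longrightarrow> card (L i) = s"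
      "\<And>i j. i < j \<Longrightarrow> j < 4 \<Longrightarrow> L i \<inter> L j = {}"
    and ker: "\<Psi> *\<^sub>v ind_vec N (\<Union>i<(4::nat). L i) = 0\<^sub>v (dim_row \<Psi>)"
  shows "1 / 5 \<le> \<delta>"
proof -
  define a where "a i = \<Psi> *\<^sub>v ind_vec N (L i)" for i
  have fin: "finite (L i)" if "i < 4" for i
    using L(1)[OF that] by (rule finite_subset) simp
  have \<Psi>: "\<Psi> \<in> carrier_mat (dim_row \<Psi>) N" using dim by auto
  have add: "\<Psi> *\<^sub>v ind_vec N (S \<union> S') = \<Psi> *\<^sub>v ind_vec N S + \<Psi> *\<^sub>v ind_vec N S'"
    if "S \<inter> S' = {}" for S S'
    using mult_add_distrib_mat_vec[OF \<Psi> ind_vec_carrier ind_vec_carrier, of S S'] ind_vec_union[OF that]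
    by simp
  have da: "dim_vec (a i) = dim_row \<Psi>" for i by (simp add: a_def)
  have "(\<Union>i<(4::nat). L i) = ((L 0 \<union> L 1) \<union> L 2) \<union> L 3"
    by (auto simp: numeral_eq_Suc lessThan_Suc)
  moreover have "(L 0 \<union> L 1) \<inter> L 2 = {}" "(L 0 \<union> L 1 \<union> L 2) \<inter> L 3 = {}" "L 0 \<inter> L 1 = {}"
    using L(3)[of 0 1] L(3)[of 0 2] L(3)[of 1 2] L(3)[of 0 3] L(3)[of 1 3] L(3)[of 2 3] by auto
  ultimately have sum0: "a 0 + a 1 + a 2 + a 3 = 0\<^sub>v (dim_row \<Psi>)"
    using ker unfolding a_def by (simp add: add)
  have comp0: "a 0 $ i + a 1 $ i + a 2 $ i + a 3 $ i = 0" if "i < dim_row \<Psi>" for i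
    using arg_cong[OF sum0, of "\<lambda>u. u $ i"] that by (simp add: da)
  have pair: "(norm2 (a i + a j))\<^sup>2 = (\<Sum>k<dim_row \<Psi>. (cmod (a i $ k + a j $ k))\<^sup>2)" for i j
    unfolding norm2_sq by (intro sum.cong) (auto simp: da)
  have single: "(norm2 (a i))\<^sup>2 = (\<Sum>k<dim_row \<Psi>. (cmod (a i $ k))\<^sup>2)" for i
    by (simp add: norm2_sq da)
  have id: "(norm2 (a 0 + a 1))\<^sup>2 + (norm2 (a 0 + a 2))\<^sup>2 + (norm2 (a 1 + a 2))\<^sup>2 =
      (norm2 (a 0))\<^sup>2 + (norm2 (a 1))\<^sup>2 + (norm2 (a 2))\<^sup>2 + (norm2 (a 3))\<^sup>2"
    unfolding pair single sum.distrib[symmetric]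
    by (intro sum.cong refl cmod_sq_four_sum_zero comp0) auto
  have up: "(norm2 (a i))\<^sup>2 \<le> (1 + \<delta>) * real s" if "i < 4" for i
    using RIP_boundD(2)[OF RIP _ supp_ind_vec fin[OF that], of N] L(2)[OF that]
      norm2_ind_vec_sq[OF L(1)[OF that]]
    by (simp add: a_def dim)
  have low: "(1 - \<delta>) * (2 * real s) \<le> (norm2 (a i + a j))\<^sup>2" if ij: "i < j" "j < 4" for i j
  proof -
    have i4: "i < 4" using ij by simp
    have c: "card (L i \<union> L j) = 2 * s"
      using L(3)[OF ij] L(2)[OF i4] L(2)[OF ij(2)] fin[OF i4] fin[OF ij(2)]
      by (simp add: card_Un_disjoint)
    have "(1 - \<delta>) * (norm2 (ind_vec N (L i \<union> L j)))\<^sup>2 \<le> (norm2 (\<Psi> *\<^sub>v ind_vec N (L i \<union> L j)))\<^sup>2"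
      using fin[OF i4] fin[OF ij(2)] c
      by (intro RIP_boundD(1)[OF RIP _ supp_ind_vec]) (auto simp: dim)
    then show ?thesis
      using L(1)[OF i4] L(1)[OF ij(2)] c
      by (simp add: norm2_ind_vec_sq add[OF L(3)[OF ij]] a_def)
  qed
  have "3 * ((1 - \<delta>) * (2 * real s)) \<le> 4 * ((1 + \<delta>) * real s)"
    using low[of 0 1] low[of 0 2] low[of 1 2] up[of 0] up[of 1] up[of 2] up[of 3] id by linarith
  then have "(6 - 6 * \<delta>) * real s \<le> (4 + 4 * \<delta>) * real s" by (simp add: algebra_simps)
  then have "6 - 6 * \<delta> \<le> 4 + 4 * \<delta>" using s by (simp add: mult_le_cancel_right)
  then show ?thesis by simp
qed

section \<open>The null space property survives the flat vector\<close>

text \<open>Let \<open>v\<close> be the indicator vector of \<open>L\<close>. A vector of \<open>ker A + span v\<close> that violates the weighted null space inequality at a set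
  of size at most \<open>s\<close> is zero. The order \<open>68 s\<close> accommodates \<open>T\<close>, a block of size \<open>63 s\<close> and
  the support of \<open>v\<close>, of size \<open>4 s\<close>.\<close>

lemma kernel_plus_flat_vector_NSP:
  fixes x :: "complex vec"
  assumes A: "A \<in> carrier_mat m N" and RIP: "RIP_bound (68 * s) (3 / 8) A" and s: "1 \<le> s"
    and L: "L \<subseteq> {..<N}" "card L = 4 * s"
    and w: "\<And>j. j < N \<Longrightarrow> 3 / 4 \<le> \<omega> $ j \<and> \<omega> $ j \<le> 1"
    and x: "x \<in> carrier_vec N" and Ax: "A *\<^sub>v x = c \<cdot>\<^sub>v (A *\<^sub>v ind_vec N L)"
    and T: "T \<subseteq> {0..<N}" "card T \<le> s"
    and bad: "wnorm1 \<omega> (restr_vec ({0..<N} - T) x) \<le> wnorm1 \<omega> (restr_vec T x)"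
  shows "x = 0\<^sub>v N"
proof -
  define U where "U = {0..<N} - T"
  define f where "f j = cmod (x $ j)" for j
  define q where "q S = norm2 (A *\<^sub>v restr_vec S x)" for S
  define y where "y = L2_set f T"
  define r where "r = sqrt (real s)"
  have dx: "dim_vec x = N" using x by simp
  have dA: "dim_col A = N" using A by simp
  have f0: "0 \<le> f j" for j by (simp add: f_def)
  have y0: "0 \<le> y" by (simp add: y_def)
  have r: "0 < r" "r\<^sup>2 = real s" using s by (auto simp: r_def)
  have finT: "finite T" using T(1) by (rule finite_subset) simp
  have finL: "finite L" using L(1) by (rule finite_subset) simp
  have U: "U \<subseteq> {0..<N}" "finite U" by (auto simp: U_def)

  have sumT: "sum f T \<le> r * y"
  proof -
    have "sum f T \<le> sqrt (real (card T)) * y" unfolding y_def by (rule sum_le_sqrt_card_L2_set)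
    also have "\<dots> \<le> r * y" using T(2) y0 by (intro mult_right_mono) (auto simp: r_def)
    finally show ?thesis .
  qed
  have sumU: "sum f U \<le> 4 / 3 * sum f T"
  proof -
    have "(\<Sum>j\<in>U. 3 / 4 * f j) \<le> (\<Sum>j\<in>U. \<omega> $ j * f j)"
      using U w f0 by (intro sum_mono mult_right_mono) auto
    also have "\<dots> \<le> (\<Sum>j\<in>T. \<omega> $ j * f j)"
      using bad wnorm1_restr[of U x \<omega>] wnorm1_restr[of T x \<omega>] U(1) T(1)
      by (simp add: dx U_def f_def)
    also have "\<dots> \<le> (\<Sum>j\<in>T. 1 * f j)"
      using T(1) w f0 by (intro sum_mono mult_right_mono) auto
    finally have "3 / 4 * sum f U \<le> sum f T" by (simp only: sum_distrib_left mult_1_left)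
    then show ?thesis by simp
  qed

  have "\<exists>B\<subseteq>U. card B \<le> 63 * s \<and> q (U - B) \<le> sqrt (11 / 8) * (sum f U / sqrt (real (63 * s)))"
  proof (rule block_decomposition)
    have "restr_vec {} x = 0\<^sub>v N" using dx by (intro eq_vecI) (auto simp: restr_vec_def)
    then have "A *\<^sub>v restr_vec {} x = 0\<^sub>v m"
      using A by (intro eq_vecI) auto
    then show "q {} = 0" by (simp add: q_def norm2_def)
  next
    fix S S' :: "nat set" assume "S \<inter> S' = {}"
    then have "restr_vec (S \<union> S') x = restr_vec S x + restr_vec S' x"
      by (intro eq_vecI) (auto simp: restr_vec_def)
    then show "q (S \<union> S') \<le> q S + q S'"
      using A x unfolding q_def
      by (simp add: mult_add_distrib_mat_vec[OF A restr_vec_carrier restr_vec_carrier] norm2_triangle)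
  next
    fix S assume S: "S \<subseteq> U" "card S \<le> 63 * s"
    have "(q S)\<^sup>2 \<le> (1 + 3 / 8) * (norm2 (restr_vec S x))\<^sup>2"
      unfolding q_def using S U x
      by (intro RIP_boundD(2)[OF RIP _ supp_restr_vec]) (auto simp: dA intro: finite_subset)
    also have "\<dots> = (sqrt (11 / 8) * L2_set f S)\<^sup>2"
      using S U norm2_restr_sq[of S x]
      by (simp add: power_mult_distrib L2_set_def sum_nonneg f_def dx lessThan_atLeast0)
    finally show "q S \<le> sqrt (11 / 8) * L2_set f S"
      by (rule power2_le_imp_le) simp
  qed (use U s f0 in auto)
  then obtain B where B: "B \<subseteq> U" "card B \<le> 63 * s"
    "q (U - B) \<le> sqrt (11 / 8) * (sum f U / sqrt (real (63 * s)))"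
    by blast
  have finB: "finite B" using B(1) U(2) by (rule finite_subset)

  \<comment> \<open>The part of \<open>x - c v\<close> that is sparse enough for the RIP.\<close>
  define z where "z = restr_vec (T \<union> B) x + (- c) \<cdot>\<^sub>v ind_vec N L"
  have z: "z \<in> carrier_vec N" using x by (simp add: z_def)
  have zi: "z $ j = (if j \<in> T \<union> B then x $ j else 0) - (if j \<in> L then c else 0)" if "j < N" for j
    using that dx by (auto simp: z_def restr_vec_def)
  have Az: "A *\<^sub>v z = - (A *\<^sub>v restr_vec (U - B) x)"
  proof (rule eq_vecI)
    fix i assume "i < dim_vec (- (A *\<^sub>v restr_vec (U - B) x))"
    then have i: "i < m" using A by simp
    have "z + restr_vec (U - B) x = x + (- c) \<cdot>\<^sub>v ind_vec N L"
      using dx by (intro eq_vecI) (auto simp: z_def restr_vec_def U_def)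
    then have "A *\<^sub>v z + A *\<^sub>v restr_vec (U - B) x = A *\<^sub>v x + (- c) \<cdot>\<^sub>v (A *\<^sub>v ind_vec N L)"
      using A x z by (simp flip: mult_add_distrib_mat_vec[OF A] mult_mat_vec[OF A])
    then have "(A *\<^sub>v z + A *\<^sub>v restr_vec (U - B) x) $ i = (A *\<^sub>v x + (- c) \<cdot>\<^sub>v (A *\<^sub>v ind_vec N L)) $ i"
      by simp
    then show "(A *\<^sub>v z) $ i = (- (A *\<^sub>v restr_vec (U - B) x)) $ i"
      using i A unfolding Ax by (simp add: eq_neg_iff_add_eq_0)
  qed (use A in auto)
  have nz: "norm2 z \<le> y / 4"
  proof -
    have "sum f U \<le> 4 / 3 * (r * y)" using sumU sumT by simp
    then have sq: "(sum f U)\<^sup>2 \<le> (4 / 3 * (r * y))\<^sup>2" using f0 by (intro power_mono) (auto simp: sum_nonneg)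
    have card: "card (T \<union> B \<union> L) \<le> 68 * s"
      using card_Un_le[of "T \<union> B" L] card_Un_le[of T B] T(2) B(2) L(2) by simp
    have "supp_vec z \<subseteq> T \<union> B \<union> L"
      using z zi by (auto simp: supp_vec_def split: if_splits)
    then have "(1 - 3 / 8) * (norm2 z)\<^sup>2 \<le> (norm2 (A *\<^sub>v z))\<^sup>2"
      using finT finB finL card z by (intro RIP_boundD(1)[OF RIP]) (auto simp: dA)
    also have "\<dots> = (q (U - B))\<^sup>2" unfolding Az by (simp add: q_def norm2_uminus)
    also have "\<dots> \<le> (sqrt (11 / 8) * (sum f U / sqrt (real (63 * s))))\<^sup>2"
      using B(3) by (intro power_mono) (auto simp: q_def norm2_nonneg)
    also have "\<dots> = 11 / 8 * ((sum f U)\<^sup>2 / (63 * r\<^sup>2))"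
      by (simp add: power_mult_distrib power_divide r(2))
    also have "\<dots> \<le> 11 / 8 * ((4 / 3 * (r * y))\<^sup>2 / (63 * r\<^sup>2))"
      using sq by (intro mult_left_mono divide_right_mono) auto
    also have "\<dots> = 22 / 567 * y\<^sup>2" using r(1) by (simp add: power_mult_distrib power_divide)
    \<comment> \<open>Division by \<open>1 - 3/8\<close>; the block size \<open>63 s\<close> makes the constant just smaller than \<open>1/16\<close>.\<close>
    finally have "(norm2 z)\<^sup>2 \<le> 176 / 2835 * y\<^sup>2" by simp
    also have "\<dots> \<le> 1 / 16 * y\<^sup>2" by (intro mult_right_mono) auto
    also have "\<dots> = (y / 4)\<^sup>2" by (simp add: power_divide)
    finally show ?thesis by (rule power2_le_imp_le) (simp add: y0)
  qed
  define g where "g j = cmod (z $ j)" for j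
  have L2g: "L2_set g S \<le> y / 4" if "S \<subseteq> {..<N}" for S
  proof -
    have "L2_set g S \<le> norm2 z"
      unfolding norm2_conv_L2_set L2_set_def g_def using z that
      by (intro real_sqrt_le_mono sum_mono2) auto
    with nz show ?thesis by simp
  qed

  have on_T: "y \<le> y / 4 + r * cmod c"
  proof -
    have "f j \<le> g j + cmod c" if "j \<in> T" for j
    proof -
      have "j < N" using that T(1) by auto
      then have "x $ j = z $ j + (if j \<in> L then c else 0)" using zi that by simp
      then show ?thesis unfolding f_def g_def
        using norm_triangle_ineq[of "z $ j" "if j \<in> L then c else 0"] by (auto split: if_splits)
    qed
    then have "y \<le> L2_set (\<lambda>j. g j + cmod c) T"
      unfolding y_def using f0 by (intro L2_set_mono) auto
    also have "\<dots> \<le> L2_set g T + L2_set (\<lambda>_. cmod c) T" by (rule L2_set_triangle_ineq)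
    also have "L2_set (\<lambda>_. cmod c) T = sqrt (real (card T)) * cmod c" by (simp add: L2_set_constant)
    also have "\<dots> \<le> r * cmod c" using T(2) by (intro mult_right_mono) (auto simp: r_def)
    finally show ?thesis using L2g[of T] T(1) by (simp add: lessThan_atLeast0)
  qed
  have on_L: "4 * r\<^sup>2 * cmod c \<le> r * (17 / 6 * y)"
  proof -
    have "4 * r\<^sup>2 * cmod c = (\<Sum>j\<in>L. cmod c)" using L(2) by (simp add: r(2))
    also have "\<dots> \<le> (\<Sum>j\<in>L. g j + f j)"
    proof (rule sum_mono)
      fix j assume j: "j \<in> L"
      then have "j < N" using L(1) by auto
      then have "c = (if j \<in> T \<union> B then x $ j else 0) - z $ j" using zi j by simp
      then show "cmod c \<le> g j + f j" unfolding f_def g_def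
        using norm_triangle_ineq4[of "x $ j" "z $ j"] by (auto split: if_splits)
    qed
    also have "\<dots> = sum g L + sum f L" by (rule sum.distrib)
    also have "sum g L \<le> sqrt (real (card L)) * L2_set g L" by (rule sum_le_sqrt_card_L2_set)
    also have "\<dots> \<le> (2 * r) * (y / 4)"
      using L2g[OF L(1)] L(2) r(1) by (intro mult_mono) (auto simp: r_def real_sqrt_mult)
    also have "sum f L \<le> sum f ({0..<N})"
      using L(1) f0 by (intro sum_mono2) auto
    also have "\<dots> = sum f U + sum f T"
      using sum.subset_diff[OF T(1)] by (simp add: U_def)
    also have "\<dots> \<le> 7 / 3 * (r * y)" using sumU sumT by simp
    finally show ?thesis by (simp add: algebra_simps)
  qed
  have "4 * r * cmod c \<le> 17 / 6 * y"
    using on_L r(1) by (simp add: power2_eq_square mult.assoc mult.left_commute)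
  \<comment> \<open>\<open>on_T\<close> gives \<open>3 y \<le> 4 r |c|\<close>, and \<open>17/6 < 3\<close>.\<close>
  with on_T have "y \<le> 0" by simp
  then have "sum f T \<le> 0" using sumT r(1) by (smt (verit) mult_nonneg_nonpos)
  moreover from this have "sum f U \<le> 0" using sumU by simp
  ultimately have "sum f {0..<N} \<le> 0"
    using sum.subset_diff[OF T(1), of f] by (simp add: U_def)
  then have "sum f {0..<N} = 0" using f0 by (simp add: antisym sum_nonneg)
  then have "\<forall>j\<in>{0..<N}. f j = 0" using f0 by (simp add: sum_nonneg_eq_0_iff)
  then show ?thesis using dx by (intro eq_vecI) (auto simp: f_def)
qed

section \<open>Existence of the matrix\<close>

lemma exists_partial_DFT_RIP:
  assumes const: "partial_DFT_RIP_constants C1 C2"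
    and "0 < \<delta>" "\<delta> < 1" "0 < t" "1 \<le> k" "1 \<le> m" "m \<le> N"
    and "C1 * t * real k * ln (real N) ^ 4 \<le> real m"
    and prob: "5 * exp (- (\<delta>\<^sup>2 * t / C2)) < 1"
  shows "\<exists>R\<subseteq>{0..<N}. card R = m \<and> RIP_const (2 * k) (partial_DFT N R) \<le> \<delta>"
proof -
  let ?X = "{R. R \<subseteq> {0..<N} \<and> card R = m}"
  let ?E = "{R. RIP_const (2 * k) (partial_DFT N R) \<le> \<delta>}"
  have "finite ?X" by (rule finite_subset[of _ "Pow {0..<N}"]) auto
  moreover have "?X \<noteq> {}" using \<open>m \<le> N\<close> by (auto intro!: exI[of _ "{0..<m}"])
  ultimately have supp: "set_pmf (pmf_of_set ?X) = ?X" by (simp add: set_pmf_of_set)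
  have "1 - 5 * exp (- (\<delta>\<^sup>2 * t / C2)) \<le> measure_pmf.prob (pmf_of_set ?X) ?E"
    using const assms(2-8) unfolding partial_DFT_RIP_constants_def by blast
  with prob have "measure_pmf.prob (pmf_of_set ?X) ?E \<noteq> 0" by simp
  then have "set_pmf (pmf_of_set ?X) \<inter> ?E \<noteq> {}"
    by (simp add: measure_pmf_zero_iff)
  with supp show ?thesis by auto
qed

lemma partial_DFT_carrier:
  assumes "R \<subseteq> {0..<N}"
  shows "partial_DFT N R \<in> carrier_mat (card R) N"
proof -
  have "{i. i < N \<and> i \<in> R} = R" using assms by auto
  then show ?thesis
    by (intro carrier_matI) (simp_all add: partial_DFT_def DFT_mat_def dim_submatrix)
qed

theorem theorem4p10:
  fixes \<gamma> C1 C2 :: real and \<omega> :: "real vec" and m s N :: nat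
  assumes "3 / 4 < \<gamma>" and "\<gamma> < 1"
    and "\<omega> \<in> carrier_vec N" and "\<forall>j<N. \<gamma> \<le> \<omega> $ j \<and> \<omega> $ j \<le> 1"
    and "partial_DFT_RIP_constants C1 C2"
    and "real N / 2 \<ge> real m"
    and "real m \<ge> 242 * ln 10 * C1 * C2 * real s * ln (real N) ^ 4"
    and "N \<ge> 24 * s"
    and "s \<ge> 3717120"
  shows "\<exists>\<Phi> \<in> carrier_mat m N. wNSP \<omega> s \<Phi> \<and> \<not> (\<exists>\<delta> < 1 / 11. RIP_NSP (2 * s) \<delta> \<Phi>)"
proof -
  have C: "C1 > 0" "C2 > 0" using assms(5) by (auto simp: partial_DFT_RIP_constants_def)
  have "0 < 242 * ln 10 * C1 * C2 * real s * ln (real N) ^ 4"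
    using C assms(8,9) by (intro mult_pos_pos zero_less_power) auto
  then have m: "1 \<le> m" "m \<le> N" using assms(6,7) by linarith+
  define t where "t = 242 * ln 10 * C2 / 34"
  have ln10: "ln (10::real) > 0" by simp
  have t0: "t > 0" using C by (simp add: t_def)
  \<comment> \<open>Sparsity \<open>34 s\<close> in place of \<open>s\<close> is paid for by the factor \<open>1/34\<close> in \<open>t\<close>.\<close>
  have size: "C1 * t * real (34 * s) * ln (real N) ^ 4 \<le> real m"
    using assms(7) by (simp add: t_def algebra_simps)
  \<comment> \<open>Holds because \<open>9 * 242 = 2178 \<ge> 2176 = 64 * 34\<close>.\<close>
  have "ln 10 \<le> (3 / 8)\<^sup>2 * t / C2" using C ln10 by (simp add: t_def power2_eq_square)
  then have "exp (- ((3 / 8)\<^sup>2 * t / C2)) \<le> exp (- ln 10)" by simp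
  also have "\<dots> = 1 / (10::real)" by (simp add: exp_minus inverse_eq_divide)
  finally have prob: "5 * exp (- ((3 / 8)\<^sup>2 * t / C2)) < 1" by simp
  obtain R where R: "R \<subseteq> {0..<N}" "card R = m"
    "RIP_const (2 * (34 * s)) (partial_DFT N R) \<le> 3 / 8"
    using exists_partial_DFT_RIP[OF assms(5) _ _ t0 _ m size prob] assms(9) by auto
  define A where "A = partial_DFT N R"
  have A: "A \<in> carrier_mat m N" using partial_DFT_carrier[OF R(1)] R(2) by (simp add: A_def)
  have "RIP_bound (2 * (34 * s)) (RIP_const (2 * (34 * s)) A) A"
    using A m assms(9) by (intro RIP_bound_RIP_const) auto
  then have RIP: "RIP_bound (68 * s) (3 / 8) A"
    using R(3) RIP_bound_mono[of "2 * (34 * s)" _ A "3 / 8"] by (simp add: A_def)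

  define L where "L i = {i * s..<(i + 1) * s}" for i :: nat
  define v where "v = ind_vec N (\<Union>i<(4::nat). L i)"
  have L_eq: "(\<Union>i<(4::nat). L i) = {..<4 * s}"
    unfolding L_def by (auto simp: numeral_eq_Suc lessThan_Suc)
  have v: "v \<in> carrier_vec N" by (simp add: v_def)
  have sub: "{..<4 * s} \<subseteq> {..<N}" using assms(8) by auto
  have "(1 - 3 / 8) * (norm2 v)\<^sup>2 \<le> (norm2 (A *\<^sub>v v))\<^sup>2"
    unfolding v_def L_eq using A assms(9)
    by (intro RIP_boundD(1)[OF RIP _ supp_ind_vec]) auto
  moreover have "(norm2 v)\<^sup>2 = real (4 * s)"
    unfolding v_def L_eq using norm2_ind_vec_sq[OF sub] by simp
  ultimately have "norm2 (A *\<^sub>v v) \<noteq> 0" using assms(9) by auto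
  moreover have "norm2 (0\<^sub>v m) = 0" by (simp add: norm2_def)
  ultimately have nz: "A *\<^sub>v v \<noteq> 0\<^sub>v m" by metis
  obtain \<Phi> where \<Phi>: "\<Phi> \<in> carrier_mat m N"
    "mat_kernel \<Phi> = {x \<in> carrier_vec N. \<exists>c. A *\<^sub>v x = c \<cdot>\<^sub>v (A *\<^sub>v v)}"
    using exists_matrix_kernel_preimage_line[OF A v nz] by blast
  have dim: "dim_col \<Phi> = N" using \<Phi>(1) by simp

  have "wNSP \<omega> s \<Phi>"
    unfolding wNSP_def dim
  proof (intro ballI allI impI)
    fix x S assume x: "x \<in> mat_kernel \<Phi> - {0\<^sub>v N}" and S: "S \<subseteq> {0..<N}" "card S \<le> s"
    then obtain c where xc: "x \<in> carrier_vec N" "A *\<^sub>v x = c \<cdot>\<^sub>v (A *\<^sub>v v)" "x \<noteq> 0\<^sub>v N"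
      using \<Phi>(2) by auto
    have w: "3 / 4 \<le> \<omega> $ j \<and> \<omega> $ j \<le> 1" if "j < N" for j using assms(1,4) that by force
    show "wnorm1 \<omega> (restr_vec S x) < wnorm1 \<omega> (restr_vec ({0..<N} - S) x)"
    proof (rule ccontr)
      assume "\<not> ?thesis"
      then have "wnorm1 \<omega> (restr_vec ({0..<N} - S) x) \<le> wnorm1 \<omega> (restr_vec S x)" by simp
      moreover have "A *\<^sub>v x = c \<cdot>\<^sub>v (A *\<^sub>v ind_vec N {..<4 * s})"
        using xc(2) by (simp add: v_def L_eq)
      ultimately have "x = 0\<^sub>v N"
        using kernel_plus_flat_vector_NSP[OF A RIP _ sub _ w xc(1) _ S] assms(9) by simp
      with xc(3) show False by contradiction
    qed
  qed
  moreover have "\<not> (\<exists>\<delta> < 1 / 11. RIP_NSP (2 * s) \<delta> \<Phi>)"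
  proof
    assume "\<exists>\<delta> < 1 / 11. RIP_NSP (2 * s) \<delta> \<Phi>"
    then obtain \<Psi> where \<Psi>: "dim_col \<Psi> = N" "mat_kernel \<Psi> = mat_kernel \<Phi>" "RIP_const (2 * s) \<Psi> < 1 / 11"
      unfolding RIP_NSP_def dim by blast
    have "v \<in> mat_kernel \<Psi>" using \<Psi>(2) \<Phi>(2) v by (auto intro!: exI[of _ 1])
    then have ker: "\<Psi> *\<^sub>v v = 0\<^sub>v (dim_row \<Psi>)" by (simp add: mat_kernel_def)
    have "RIP_bound (2 * s) (RIP_const (2 * s) \<Psi>) \<Psi>"
      using \<Psi>(1) m assms(9) by (intro RIP_bound_RIP_const) auto
    then have "1 / 5 \<le> RIP_const (2 * s) \<Psi>"
    proof (rule RIP_bound_ge_if_flat_kernel_vector[OF _ \<Psi>(1) _ _ _ _ ker[unfolded v_def]])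
      show "L i \<subseteq> {..<N}" if "i < 4" for i using that sub unfolding L_eq[symmetric] by blast
      show "L i \<inter> L j = {}" if "i < j" for i j
      proof -
        have "(i + 1) * s \<le> j * s" using that by (intro mult_le_mono1) simp
        then show ?thesis unfolding L_def by (simp add: disjoint_iff)
      qed
    qed (use assms(9) in \<open>auto simp: L_def\<close>)
    with \<Psi>(3) show False by simp
  qed
  ultimately show ?thesis using \<Phi>(1) by blast
qed

end
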